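(* Let $n\ge1$ and let $f:\mathbb{R}\to\mathbb{R}$ be a discontinuous $n$-monomial function. Let $\Gamma_f$ be the closure in $\mathbb{R}^2$ of the graph $G(f)=\{(x,f(x)):x\in\mathbb{R}\}$, and let $\Omega_f$ be the interior of $\Gamma_f$. Then $G(f)$ is connected if and only if $G(f)\cap K\neq\emptyset$ for every continuum $K\subseteq\Omega_f$ which touches two distinct vertical lines.
   Context: For $h\in\mathbb{R}$, $\Delta_h f(x)=f(x+h)-f(x)$ and $\Delta_h^{n}=\Delta_h\circ\Delta_h^{n-1}$. A function $f:\mathbb{R}\to\mathbb{R}$ is an $n$-monomial function if $\frac{1}{n!}\Delta_h^n f(x)=f(h)$ for all $x,h\in\mathbb{R}$. A continuum is a compact connected subset of $\mathbb{R}^2$ containing more than one point. A set $K\subseteq\mathbb{R}^2$ touches two distinct vertical lines if it contains points $(x_0,y_0),(x_1,y_1)$ with $x_0\neq x_1$. *)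

theory Defs
  imports "HOL-Analysis.Analysis"
begin

definition diff_op :: "real \<Rightarrow> (real \<Rightarrow> real) \<Rightarrow> (real \<Rightarrow> real)" where
  "diff_op h f = (\<lambda>x. f (x + h) - f x)"

definition monomial_fun :: "nat \<Rightarrow> (real \<Rightarrow> real) \<Rightarrow> bool" where
  "monomial_fun n f \<longleftrightarrow> (\<forall>x h. (1 / fact n) * ((diff_op h ^^ n) f) x = f h)"

definition graph_of :: "(real \<Rightarrow> real) \<Rightarrow> (real \<times> real) set" where
  "graph_of f = {(x, f x) | x. True}"

definition continuum :: "(real \<times> real) set \<Rightarrow> bool" where
  "continuum K \<longleftrightarrow> compact K \<and> connected K \<and> (\<exists>p\<in>K. \<exists>q\<in>K. p \<noteq> q)"

definition touches_two_vertical_lines :: "(real \<times> real) set \<Rightarrow> bool" where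
  "touches_two_vertical_lines K \<longleftrightarrow> (\<exists>p\<in>K. \<exists>q\<in>K. fst p \<noteq> fst q)"

end

theory Submission
  imports Defs "HOL-Computational_Algebra.Polynomial"
begin

text \<open>
  A connected graph meets \<open>K\<close> for every function \<open>f\<close>: the restrictions of \<open>f\<close> to intervals have
  connected graphs, \<open>K\<close> separates the top from the bottom of a vertical strip, and the closure of
  the graph contains points of the strip above \<open>K\<close> and points below it.

  Conversely, put \<open>g x = f x / x ^ n\<close> for \<open>x > 0\<close>. Since \<open>f\<close> is homogeneous for rational factors and
  polynomial along rational points of lines, the graph of \<open>g\<close> is dense in \<open>{0<..} \<times> S\<close> for a closed
  interval \<open>S\<close>, nondegenerate because \<open>f\<close> is discontinuous. Suppose open sets \<open>U\<close>, \<open>V\<close> disconnect the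
  graph of \<open>g\<close>. In each rectangle inside \<open>{0<..} \<times> interior S\<close> some component of the complement of
  \<open>U \<union> V\<close> separates \<open>U\<close> from \<open>V\<close>. If it is not vertical, it yields a continuum that misses the graph.
  If it is vertical in all rectangles, a compactness argument gives a full line \<open>{x} \<times> S\<close> outside
  \<open>U \<union> V\<close>, which is absurd as it contains \<open>(x, g x)\<close>. The graph over the negative half-line is a
  reflection of the positive part, and both have \<open>(0, 0)\<close> in common.
\<close>

section \<open>Monomial functions on rational lines\<close>

lemma diff_op_of_nat_mult:
  "diff_op (real m * h) F = (\<lambda>x. \<Sum>j<m. diff_op h F (x + real j * h))"
proof
  fix x
  show "diff_op (real m * h) F x = (\<Sum>j<m. diff_op h F (x + real j * h))"
    by (induction m) (simp_all add: diff_op_def algebra_simps)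
qed

lemma funpow_diff_op_sum_shift:
  "(diff_op h ^^ k) (\<lambda>x. \<Sum>j\<in>A. F (x + s j)) = (\<lambda>x. \<Sum>j\<in>A. (diff_op h ^^ k) F (x + s j))"
proof (induction k)
  case (Suc k)
  then show ?case
    by (simp add: diff_op_def sum_subtractf algebra_simps)
qed simp

text \<open>A difference with step \<open>m * h\<close> telescopes into \<open>m\<close> shifted
  differences with step \<open>h\<close>. Shifts do not affect a constant, so each of the
  \<open>k\<close> differences contributes one factor \<open>m\<close>.\<close>

lemma funpow_diff_op_of_nat_mult:
  assumes "\<And>x. (diff_op h ^^ k) F x = c"
  shows "(diff_op (real m * h) ^^ k) F x = real m ^ k * c"
  using assms
proof (induction k arbitrary: F c x)
  case (Suc k)
  let ?F' = "diff_op (real m * h) F"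
  have step: "(diff_op h ^^ k) (diff_op h F) x = c" for x
    using Suc.prems[of x] by (simp add: funpow_swap1)
  have "(diff_op h ^^ k) ?F' x = real m * c" for x
    unfolding diff_op_of_nat_mult[of m h F]
    by (simp add: funpow_diff_op_sum_shift[where F = "diff_op h F"] step)
  from Suc.IH[OF this, of x] show ?case
    by (simp add: funpow_swap1 algebra_simps)
qed simp

text \<open>A backward difference is a shifted forward difference with opposite sign, so each of the
  \<open>k\<close> differences contributes one sign.\<close>

lemma funpow_diff_op_uminus:
  assumes "\<And>x. (diff_op h ^^ k) F x = c"
  shows "(diff_op (- h) ^^ k) F x = (- 1) ^ k * c"
  using assms
proof (induction k arbitrary: F c x)
  case (Suc k)
  let ?F' = "diff_op (- h) F"
  have step: "(diff_op h ^^ k) (diff_op h F) x = c" for x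
    using Suc.prems[of x] by (simp add: funpow_swap1)
  have F': "?F' = (\<lambda>x. - diff_op h F (x - h))"
    by (simp add: diff_op_def)
  have "(diff_op h ^^ j) (\<lambda>x. - G (x - h)) = (\<lambda>x. - (diff_op h ^^ j) G (x - h))" for G and j :: nat
    by (induction j) (simp_all add: diff_op_def algebra_simps)
  then have "(diff_op h ^^ k) ?F' x = - c" for x
    unfolding F' by (simp add: step)
  from Suc.IH[OF this, of x] show ?case
    by (simp add: funpow_swap1)
qed simp

text \<open>Induction on \<open>m\<close>: one more step adds the same expansion for
  \<open>diff_op h F\<close>, and Pascal's rule merges the two sums. The bound \<open>N\<close> is
  kept apart from \<open>m\<close> because binomials with \<open>k > m\<close> vanish; the sum can
  thus be truncated at a degree independent of \<open>m\<close>.\<close>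

lemma newton_forward_difference:
  "m \<le> N \<Longrightarrow> F (x + real m * h) = (\<Sum>k\<le>N. real (m choose k) * (diff_op h ^^ k) F x)"
proof (induction m arbitrary: F N)
  case 0
  have "(\<Sum>k\<le>N. real (0 choose k) * (diff_op h ^^ k) F x) = (\<Sum>k\<in>{0}. real (0 choose k) * (diff_op h ^^ k) F x)"
    by (rule sum.mono_neutral_right) auto
  then show ?case by simp
next
  case (Suc m)
  then obtain M where N: "N = Suc M" and M: "m \<le> M"
    by (cases N) auto
  have "F (x + real (Suc m) * h) = F (x + real m * h) + diff_op h F (x + real m * h)"
    by (simp add: diff_op_def algebra_simps)
  also have "\<dots> = (\<Sum>k\<le>N. real (m choose k) * (diff_op h ^^ k) F x)
      + (\<Sum>k\<le>M. real (m choose k) * (diff_op h ^^ k) (diff_op h F) x)"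
    using Suc.IH[of N F] Suc.IH[of M "diff_op h F"] Suc.prems M by simp
  also have "\<dots> = (\<Sum>k\<le>N. real (Suc m choose k) * (diff_op h ^^ k) F x)"
    unfolding N sum.atMost_Suc_shift
    by (simp add: sum.distrib algebra_simps funpow_swap1)
  finally show ?case .
qed

text \<open>Newton's expansion stops at order \<open>n\<close>, and each binomial coefficient
  \<open>m choose k\<close> is a polynomial in \<open>m\<close>.\<close>

lemma poly_on_nat_of_funpow_diff_op_zero:
  assumes "\<And>k x. k > n \<Longrightarrow> (diff_op h ^^ k) F x = 0"
  shows "\<exists>p. \<forall>m. F (x + real m * h) = poly p (real m)"
proof (intro exI allI)
  fix m
  let ?p = "\<Sum>k\<le>n. smult ((diff_op h ^^ k) F x / fact k) (\<Prod>i=0..<k. [:- real i, 1:])"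
  \<comment> \<open>The bound must be at least \<open>m\<close> for Newton's formula and at least
    \<open>n\<close> so that the cut to \<open>k \<le> n\<close> is possible.\<close>
  have "F (x + real m * h) = (\<Sum>k\<le>max m n. real (m choose k) * (diff_op h ^^ k) F x)"
    by (rule newton_forward_difference) simp
  also have "\<dots> = (\<Sum>k\<le>n. real (m choose k) * (diff_op h ^^ k) F x)"
    by (rule sum.mono_neutral_right) (auto simp: assms)
  also have "\<dots> = poly ?p (real m)"
    by (simp add: poly_sum poly_prod binomial_gbinomial gbinomial_prod_rev algebra_simps)
  finally show "F (x + real m * h) = poly ?p (real m)" .
qed

section \<open>Homogeneity of monomial functions under rational factors\<close>

lemma monomial_fun_diff_op:
  assumes "monomial_fun n f"
  shows "(diff_op h ^^ n) f x = fact n * f h"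
  using assms unfolding monomial_fun_def by (auto simp: field_simps)

lemma monomial_fun_diff_op_zero:
  assumes "monomial_fun n f" "k > n"
  shows "(diff_op h ^^ k) f x = 0"
proof -
  have "(diff_op h ^^ (Suc j + n)) f = (\<lambda>x. 0)" for j
  proof (induction j)
    case 0
    then show ?case
      by (simp add: diff_op_def[of h "(diff_op h ^^ n) f"] monomial_fun_diff_op[OF assms(1)])
  qed (simp add: diff_op_def)
  moreover obtain j where "k = Suc j + n"
    using less_imp_Suc_add[OF assms(2)] by (auto simp: add.commute)
  ultimately show ?thesis by simp
qed

lemma monomial_fun_of_nat_mult:
  assumes "monomial_fun n f"
  shows "f (real m * h) = real m ^ n * f h"
  using funpow_diff_op_of_nat_mult[where F = f and k = n and x = 0 and m = m and h = h,
      OF monomial_fun_diff_op[OF assms]]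
  by (simp add: monomial_fun_diff_op[OF assms])

lemma monomial_fun_uminus:
  assumes "monomial_fun n f"
  shows "f (- h) = (- 1) ^ n * f h"
  using funpow_diff_op_uminus[where F = f and k = n and x = 0 and h = h,
      OF monomial_fun_diff_op[OF assms]]
  by (simp add: monomial_fun_diff_op[OF assms])

lemma nonneg_Rats_cases:
  assumes "q \<in> \<rat>" "(q::real) \<ge> 0"
  obtains i N :: nat where "N > 0" "q = real i / real N"
proof -
  obtain i N where "N \<noteq> 0" "\<bar>q\<bar> = real i / real N"
    using Rats_abs_nat_div_natE[OF assms(1)] by metis
  with assms(2) that show thesis by auto
qed

lemma monomial_fun_rat_mult:
  assumes "monomial_fun n f" "q \<in> \<rat>" "q \<ge> 0"
  shows "f (q * h) = q ^ n * f h"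
proof -
  obtain i N where N: "N > 0" and q: "q = real i / real N"
    using assms nonneg_Rats_cases by metis
  have "real N ^ n * f (q * h) = f (real N * (q * h))"
    using monomial_fun_of_nat_mult[OF assms(1)] by simp
  also have "real N * (q * h) = real i * h"
    using N q by simp
  also have "f (real i * h) = real i ^ n * f h"
    by (rule monomial_fun_of_nat_mult[OF assms(1)])
  also have "real i ^ n = real N ^ n * q ^ n"
    using N q by (simp add: power_divide)
  finally show ?thesis
    using N by simp
qed

section \<open>Polynomial behaviour along rational points of lines\<close>

lemma poly_eqI_of_nat:
  fixes p q :: "real poly"
  assumes "\<And>m. poly p (real m) = poly q (real m)"
  shows "p = q"
proof (rule ccontr)
  assume "p \<noteq> q"
  then have "finite {x. poly (p - q) x = 0}"
    by (intro poly_roots_finite) simp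
  moreover have "range real \<subseteq> {x. poly (p - q) x = 0}"
    using assms by auto
  ultimately have "finite (range real)"
    using finite_subset by blast
  then show False
    using inj_of_nat finite_imageD infinite_UNIV_nat by blast
qed

text \<open>Every step size \<open>h / N\<close> has its own polynomial on the natural multiples. It
  agrees with the polynomial for \<open>h\<close> at all natural numbers after rescaling by
  \<open>N\<close>, hence identically, so one polynomial serves all denominators.\<close>

lemma monomial_fun_poly_on_rats:
  assumes "monomial_fun n f"
  shows "\<exists>p. \<forall>q\<in>\<rat>. q \<ge> 0 \<longrightarrow> f (x + q * h) = poly p q"
proof -
  have ex: "\<exists>p. \<forall>m. f (x + real m * h) = poly p (real m)" for h
    by (rule poly_on_nat_of_funpow_diff_op_zero) (rule monomial_fun_diff_op_zero[OF assms])
  obtain p where p: "\<And>m. f (x + real m * h) = poly p (real m)"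
    using ex by metis
  have "f (x + q * h) = poly p q" if q: "q \<in> \<rat>" "q \<ge> 0" for q
  proof -
    obtain i N where N: "N > 0" and q: "q = real i / real N"
      using q nonneg_Rats_cases by metis
    obtain r where r: "\<And>m. f (x + real m * (h / real N)) = poly r (real m)"
      using ex by metis
    have "p = pcompose r [:0, real N:]"
    proof (rule poly_eqI_of_nat)
      fix m
      have "f (x + real (m * N) * (h / real N)) = f (x + real m * h)"
        using N by simp
      then show "poly p (real m) = poly (pcompose r [:0, real N:]) (real m)"
        using p[of m] r[of "m * N"] by (simp add: poly_pcompose)
    qed
    then show ?thesis
      using r[of i] N q by (simp add: poly_pcompose)
  qed
  then show ?thesis by blast
qed

text \<open>This is the interval \<open>S\<close> over which the normalized graph is dense. The
  closure makes it the fibre of the closed normalized graph over every positive abscissa.\<close>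

definition ratio_set :: "nat \<Rightarrow> (real \<Rightarrow> real) \<Rightarrow> real set" where
  "ratio_set n f = closure ((\<lambda>x. f x / x ^ n) ` {0<..})"

text \<open>At rational points of the segment from \<open>x\<close> to \<open>y\<close> the ratio
  agrees with a continuous rational function. That function takes the value \<open>v\<close>
  somewhere, and rational parameters approximate this place.\<close>

lemma ratio_between_mem_ratio_set:
  assumes f: "monomial_fun n f" and x: "x > 0" and y: "y > 0"
    and v: "f x / x ^ n \<le> v" "v \<le> f y / y ^ n"
  shows "v \<in> ratio_set n f"
proof -
  obtain p where p: "\<And>q. q \<in> \<rat> \<Longrightarrow> q \<ge> 0 \<Longrightarrow> f (x + q * (y - x)) = poly p q"
    using monomial_fun_poly_on_rats[OF f] by metis
  have pos: "x + t * (y - x) > 0" if "t \<in> {0..1}" for t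
  proof -
    have "x + t * (y - x) = (1 - t) * x + t * y" by (simp add: algebra_simps)
    moreover have "(1 - t) * x + t * y > 0"
      using that x y by (cases "t = 1") (auto intro!: add_pos_nonneg)
    ultimately show ?thesis by simp
  qed
  define r where "r t = poly p t / (x + t * (y - x)) ^ n" for t
  have cont: "continuous_on {0..1} r"
    unfolding r_def using pos by (intro continuous_intros) force
  have "r 0 = f x / x ^ n" "r 1 = f y / y ^ n"
    using p[of 0] p[of 1] by (auto simp: r_def)
  then obtain t where t: "t \<in> {0..1}" "r t = v"
    using IVT'[of r 0 v 1] v cont by auto
  \<comment> \<open>Rationals are dense in every open set, so the density is shown in the open
    interval and the end points come from its closure.\<close>
  have "{0..1} \<subseteq> closure (\<rat> \<inter> {0<..<1::real})"
  proof -
    have "closure {0<..<1::real} \<subseteq> closure (closure (\<rat> \<inter> {0<..<1}))"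
      using open_Int_closure_subset[of "{0<..<1::real}" \<rat>]
      by (intro closure_mono) (auto simp: Rats_closure_real Int_commute)
    then show ?thesis by simp
  qed
  then have "t \<in> closure (\<rat> \<inter> {0<..<1})"
    using t by blast
  moreover have "closure (\<rat> \<inter> {0<..<1}) \<subseteq> {0..1::real}"
    by (rule closure_minimal) auto
  then have "r ` closure (\<rat> \<inter> {0<..<1}) \<subseteq> ratio_set n f"
  proof (intro image_closure_subset)
    show "continuous_on (closure (\<rat> \<inter> {0<..<1})) r"
      using cont \<open>closure (\<rat> \<inter> {0<..<1}) \<subseteq> {0..1::real}\<close> continuous_on_subset by blast
    show "r ` (\<rat> \<inter> {0<..<1}) \<subseteq> ratio_set n f"
    proof (clarify)
      fix q :: real assume q: "q \<in> \<rat>" "q \<in> {0<..<1}"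
      then have "r q = f (x + q * (y - x)) / (x + q * (y - x)) ^ n" "x + q * (y - x) > 0"
        using p pos[of q] by (auto simp: r_def)
      then show "r q \<in> ratio_set n f"
        unfolding ratio_set_def by (intro closure_subset[THEN subsetD]) auto
    qed
  qed (simp add: ratio_set_def)
  ultimately show ?thesis using t by blast
qed

lemma convex_ratio_set:
  assumes "monomial_fun n f"
  shows "convex (ratio_set n f)"
proof -
  have "v \<in> ratio_set n f"
    if u: "u \<in> ratio_set n f" and w: "w \<in> ratio_set n f" and "u \<le> v" "v \<le> w" for u v w
  proof (cases "u = v \<or> v = w")
    case False
    \<comment> \<open>The tolerances \<open>v - u\<close> and \<open>w - v\<close> keep the two
      approximating ratios on their own sides of \<open>v\<close>.\<close>
    obtain x where "x > 0" "dist (f x / x ^ n) u < v - u"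
      using u False \<open>u \<le> v\<close> unfolding ratio_set_def closure_approachable
      by (auto dest: spec[of _ "v - u"])
    moreover obtain y where "y > 0" "dist (f y / y ^ n) w < w - v"
      using w False \<open>v \<le> w\<close> unfolding ratio_set_def closure_approachable
      by (auto dest: spec[of _ "w - v"])
    ultimately show ?thesis
      using ratio_between_mem_ratio_set[OF assms, of x y v] by (auto simp: dist_real_def)
  qed (use u w in auto)
  then show ?thesis
    unfolding is_interval_convex_1[symmetric] is_interval_1 by blast
qed

text \<open>A convex set of reals with empty interior has at most one point. The ratio would then be
  a constant \<open>c\<close>, and the value at 0 and parity would give
  \<open>f x = c * x ^ n\<close> everywhere, a continuous function.\<close>

lemma interior_ratio_set_nonempty:
  assumes n: "n \<ge> 1" and f: "monomial_fun n f" and disc: "\<not> continuous_on UNIV f"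
  shows "interior (ratio_set n f) \<noteq> {}"
proof
  assume empty: "interior (ratio_set n f) = {}"
  define c where "c = f 1"
  have mem: "f x / x ^ n \<in> ratio_set n f" if "x > 0" for x
    unfolding ratio_set_def using that by (intro closure_subset[THEN subsetD]) auto
  have eq: "u = w" if "u \<in> ratio_set n f" "w \<in> ratio_set n f" for u w
  proof (rule ccontr)
    assume "u \<noteq> w"
    then have "{min u w<..<max u w} \<noteq> {}"
      by (auto simp: min_def max_def)
    moreover have "{min u w<..<max u w} \<subseteq> interior (ratio_set n f)"
    proof (rule interior_maximal)
      have "is_interval (ratio_set n f)"
        using convex_ratio_set[OF f] is_interval_convex_1 by blast
      then show "{min u w<..<max u w} \<subseteq> ratio_set n f"
        using mem_is_interval_1_I[of "ratio_set n f" "min u w" "max u w"] that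
        by (auto simp: min_def max_def)
    qed simp
    ultimately show False using empty by simp
  qed
  have const: "f x / x ^ n = f 1 / 1 ^ n" if "x > 0" for x
    by (rule eq[OF mem[OF that] mem[OF zero_less_one]])
  have pos: "f x = c * x ^ n" if "x > 0" for x
    using const[OF that] that by (simp add: c_def field_simps)
  have "f x = c * x ^ n" for x
  proof -
    consider "x > 0" | "x = 0" | "x < 0" by linarith
    then show ?thesis
    proof cases
      case 2
      then show ?thesis
        using monomial_fun_of_nat_mult[OF f, of 0 1] n by simp
    next
      case 3
      have "f x = (- 1) ^ n * f (- x)"
        using monomial_fun_uminus[OF f, of "- x"] by simp
      then show ?thesis
        using 3 pos[of "- x"] by (simp add: power_minus[of x])
    qed (rule pos)
  qed
  then have f_eq: "f = (\<lambda>x. c * x ^ n)" by (rule ext)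
  have "continuous_on UNIV f"
    unfolding f_eq by (intro continuous_intros)
  with disc show False by simp
qed

text \<open>The ratio is invariant under positive rational factors: pick \<open>z\<close> whose
  ratio is close to \<open>s\<close>, then a rational \<open>q\<close> moving \<open>q * z\<close>
  close to \<open>x\<close>.\<close>

lemma graph_ratio_dense:
  assumes f: "monomial_fun n f"
  shows "{0<..} \<times> ratio_set n f \<subseteq> closure ((\<lambda>x. (x, f x / x ^ n)) ` {0<..})"
proof clarify
  fix x s :: real
  assume x: "0 < x" and s: "s \<in> ratio_set n f"
  show "(x, s) \<in> closure ((\<lambda>x. (x, f x / x ^ n)) ` {0<..})"
    unfolding closure_approachable
  proof (intro allI impI)
    fix e :: real assume e: "e > 0"
    obtain z where z: "z > 0" "dist (f z / z ^ n) s < e / 2"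
      using s e unfolding ratio_set_def closure_approachable by (auto dest: spec[of _ "e / 2"])
    obtain q where q: "q \<in> \<rat>" "x / z < q" "q < (x + e / 2) / z"
      using Rats_dense_in_real[of "x / z" "(x + e / 2) / z"] z e by (auto simp: divide_strict_right_mono)
    have "x / z > 0" using x z by simp
    then have "q > 0" using q by linarith
    have qz: "x < q * z" "q * z < x + e / 2"
      using q z by (auto simp: field_simps)
    have "f (q * z) / (q * z) ^ n = f z / z ^ n"
      using monomial_fun_rat_mult[OF f q(1), of z] \<open>q > 0\<close> by (simp add: power_mult_distrib)
    then have "dist (q * z, f (q * z) / (q * z) ^ n) (x, s) \<le> dist (q * z) x + dist (f z / z ^ n) s"
      by (simp add: dist_Pair_Pair sqrt_sum_squares_le_sum)
    also have "\<dots> < e"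
      using qz z by (auto simp: dist_real_def)
    finally show "\<exists>y\<in>(\<lambda>x. (x, f x / x ^ n)) ` {0<..}. dist y (x, s) < e"
      using \<open>q > 0\<close> z by auto
  qed
qed

section \<open>Continua in the complement of a disconnected graph\<close>

lemma touches_two_vertical_lines_imp_continuum:
  "compact K \<Longrightarrow> connected K \<Longrightarrow> touches_two_vertical_lines K \<Longrightarrow> continuum K"
  unfolding continuum_def touches_two_vertical_lines_def by fastforce

lemma touches_two_vertical_lines_mono:
  "touches_two_vertical_lines K \<Longrightarrow> K \<subseteq> L \<Longrightarrow> touches_two_vertical_lines L"
  unfolding touches_two_vertical_lines_def by fast

lemma open_convex_real_enlarge:
  fixes J :: "real set"
  assumes J: "open J" "convex J" and xy: "x \<in> J" "y \<in> J"
  obtains a b where "a < x" "a < y" "x < b" "y < b" "{a..b} \<subseteq> J"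
proof -
  have "min x y \<in> J" "max x y \<in> J"
    using xy by (auto simp: min_def max_def)
  then obtain e1 e2 where e: "e1 > 0" "cball (min x y) e1 \<subseteq> J" "e2 > 0" "cball (max x y) e2 \<subseteq> J"
    using J(1) open_contains_cball by metis
  have mem: "min x y - e1 \<in> J" "max x y + e2 \<in> J"
    using e by (auto simp: subset_iff dist_real_def)
  have "is_interval J"
    using J(2) by (simp add: is_interval_convex_1)
  show thesis
  proof (rule that[of "min x y - e1" "max x y + e2"])
    show "{min x y - e1..max x y + e2} \<subseteq> J"
      using mem_is_interval_1_I[OF \<open>is_interval J\<close> mem] by auto
  qed (use e in auto)
qed

text \<open>Each open half-plane together with the points of the line outside \<open>C\<close> lies
  between the half-plane and its closure, hence is connected, and the two pieces share a point. So a
  subset of a vertical line that separates the plane is the whole line.\<close>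

lemma connected_Compl_subset_vertical_line:
  fixes C :: "(real \<times> real) set"
  assumes "C \<subseteq> {s} \<times> UNIV" "C \<noteq> {s} \<times> UNIV"
  shows "connected (- C)"
proof -
  let ?T = "{s} \<times> UNIV - C" and ?L = "{..<s} \<times> (UNIV :: real set)" and ?R = "{s<..} \<times> (UNIV :: real set)"
  have "connected (?L \<union> ?T)"
  proof (rule connected_intermediate_closure)
    show "connected ?L" by (intro connected_Times) auto
    show "?L \<union> ?T \<subseteq> closure ?L" by (auto simp: closure_Times)
  qed simp
  moreover have "connected (?R \<union> ?T)"
  proof (rule connected_intermediate_closure)
    show "connected ?R" by (intro connected_Times) auto
    show "?R \<union> ?T \<subseteq> closure ?R" by (auto simp: closure_Times)
  qed simp
  moreover have "?T \<noteq> {}"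
    using assms by blast
  then have "(?L \<union> ?T) \<inter> (?R \<union> ?T) \<noteq> {}"
    by blast
  ultimately have "connected ((?L \<union> ?T) \<union> (?R \<union> ?T))"
    by (rule connected_Un)
  moreover have "(?L \<union> ?T) \<union> (?R \<union> ?T) = - C"
    using assms(1) by fastforce
  ultimately show ?thesis by simp
qed

lemma not_connected_component_disjoint_open:
  assumes "open U" "open V" "U \<inter> V = {}" "p \<in> U" "q \<in> V"
  shows "\<not> connected_component (U \<union> V) p q"
proof
  assume "connected_component (U \<union> V) p q"
  then obtain T where "connected T" "T \<subseteq> U \<union> V" "p \<in> T" "q \<in> T"
    by (auto simp: connected_component_def)
  then show False
    using assms connectedD[of T U V] by blast
qed

lemma homeomorphic_open_interval_real:
  fixes a b :: real
  assumes "a < b"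
  obtains \<alpha> :: "real \<Rightarrow> real" where "continuous_on UNIV \<alpha>" "inj \<alpha>" "range \<alpha> = {a<..<b}"
proof -
  have "ball ((a + b) / 2) ((b - a) / 2) = {a<..<b}"
    by (simp add: ball_eq_greaterThanLessThan field_simps)
  moreover have "ball ((a + b) / 2) ((b - a) / 2) homeomorphic (UNIV :: real set)"
    using assms by (intro homeomorphic_ball_UNIV) simp
  ultimately have "(UNIV :: real set) homeomorphic {a<..<b}"
    using homeomorphic_sym by metis
  then obtain \<alpha> \<beta> :: "real \<Rightarrow> real" where "homeomorphism UNIV {a<..<b} \<alpha> \<beta>"
    unfolding homeomorphic_def by blast
  then show thesis
    by (intro that[of \<alpha>]) (auto simp: homeomorphism_def intro: inj_on_inverseI)
qed

text \<open>
  A component of the complement of \<open>U \<union> V\<close> separating \<open>p\<close> from \<open>q\<close> may be unbounded in plane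
  coordinates for the open rectangle, but the closure of its image in the closed rectangle is a
  continuum.
\<close>

lemma continuum_separating_in_rectangle:
  fixes U V :: "(real \<times> real) set"
  assumes UV: "open U" "open V" "U \<inter> V = {}" and ab: "a < b" and cd: "c < d"
    and p: "p \<in> U \<inter> {a<..<b} \<times> {c<..<d}" and q: "q \<in> V \<inter> {a<..<b} \<times> {c<..<d}"
  shows "(\<exists>K. compact K \<and> connected K \<and> K \<subseteq> {a..b} \<times> {c..d} - (U \<union> V) \<and> touches_two_vertical_lines K)
    \<or> (\<exists>x\<in>{a..b}. {x} \<times> {c..d} \<subseteq> - (U \<union> V))"
proof -
  obtain \<alpha> :: "real \<Rightarrow> real" where \<alpha>: "continuous_on UNIV \<alpha>" "inj \<alpha>" "range \<alpha> = {a<..<b}"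
    using homeomorphic_open_interval_real[OF ab] .
  obtain \<beta> :: "real \<Rightarrow> real" where \<beta>: "continuous_on UNIV \<beta>" "inj \<beta>" "range \<beta> = {c<..<d}"
    using homeomorphic_open_interval_real[OF cd] .
  \<comment> \<open>The product form identifies the plane with the open rectangle while sending
    vertical lines to vertical segments; separation theorems for the whole plane become
    applicable.\<close>
  define \<psi> where "\<psi> = (\<lambda>z. (\<alpha> (fst z), \<beta> (snd z)))"
  have cont: "continuous_on UNIV \<psi>"
    unfolding \<psi>_def
    by (intro continuous_on_Pair continuous_on_compose2[OF \<alpha>(1)] continuous_on_compose2[OF \<beta>(1)]
        continuous_intros) auto
  have op: "open (\<psi> -` U)" "open (\<psi> -` V)"
    using UV by (auto intro: open_vimage cont)
  have surj: "z \<in> range \<psi>" if "z \<in> {a<..<b} \<times> {c<..<d}" for z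
  proof -
    have "fst z \<in> range \<alpha>" "snd z \<in> range \<beta>"
      using that unfolding \<alpha>(3) \<beta>(3) by auto
    then obtain s t where "fst z = \<alpha> s" "snd z = \<beta> t"
      by blast
    then have "z = \<psi> (s, t)" by (simp add: \<psi>_def prod_eq_iff)
    then show ?thesis by blast
  qed
  obtain p' q' where "p = \<psi> p'" "q = \<psi> q'"
    using surj[of p] surj[of q] p q by blast
  then have "p' \<in> \<psi> -` U" "q' \<in> \<psi> -` V" using p q by auto
  then have "\<not> connected_component (\<psi> -` U \<union> \<psi> -` V) p' q'"
    using op UV(3) by (intro not_connected_component_disjoint_open) auto
  then have "\<not> connected_component (- (- (\<psi> -` U \<union> \<psi> -` V))) p' q'"
    by simp
  moreover have "closed (- (\<psi> -` U \<union> \<psi> -` V))"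
    using op by auto
  \<comment> \<open>If a closed set separates two points of the plane, then already one of its
    components does.\<close>
  ultimately obtain C where C: "C \<in> components (- (\<psi> -` U \<union> \<psi> -` V))"
    and sep: "\<not> connected_component (- C) p' q'"
    using separation_by_component_closed_pointwise by blast
  have CF: "\<psi> ` C \<subseteq> - (U \<union> V)"
    using in_components_subset[OF C] by auto
  have pq': "p' \<in> - C" "q' \<in> - C"
    using in_components_subset[OF C] \<open>p' \<in> \<psi> -` U\<close> \<open>q' \<in> \<psi> -` V\<close> by auto
  have CR: "\<psi> ` C \<subseteq> {a..b} \<times> {c..d}"
  proof (rule image_subsetI)
    fix z
    have "\<alpha> (fst z) \<in> {a<..<b}" "\<beta> (snd z) \<in> {c<..<d}"
      unfolding \<alpha>(3)[symmetric] \<beta>(3)[symmetric] by auto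
    then show "\<psi> z \<in> {a..b} \<times> {c..d}"
      by (simp add: \<psi>_def)
  qed
  show ?thesis
  proof (cases "\<exists>z\<in>C. \<exists>w\<in>C. fst z \<noteq> fst w")
    case True
    have "closure (\<psi> ` C) \<subseteq> {a..b} \<times> {c..d}"
      by (intro closure_minimal CR closed_Times) auto
    moreover have "closure (\<psi> ` C) \<subseteq> - (U \<union> V)"
      using UV by (intro closure_minimal CF) auto
    moreover have "compact (closure (\<psi> ` C))"
      using CR bounded_subset[OF bounded_Times[OF bounded_closed_interval bounded_closed_interval]]
      by (auto simp: compact_closure)
    moreover have "connected (closure (\<psi> ` C))"
      using cont in_components_connected[OF C]
      by (intro connected_imp_connected_closure connected_continuous_image) (auto intro: continuous_on_subset)
    moreover have "touches_two_vertical_lines (\<psi> ` C)"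
      using True \<alpha>(2) unfolding touches_two_vertical_lines_def \<psi>_def by (auto dest: injD)
    then have "touches_two_vertical_lines (closure (\<psi> ` C))"
      using closure_subset by (rule touches_two_vertical_lines_mono)
    ultimately show ?thesis by (simp only: Diff_eq) (meson Int_greatest)
  next
    case False
    obtain z where "z \<in> C" using in_components_nonempty[OF C] by blast
    have sub: "C \<subseteq> {fst z} \<times> UNIV"
    proof
      fix w assume "w \<in> C"
      with False \<open>z \<in> C\<close> have "fst w = fst z" by blast
      then show "w \<in> {fst z} \<times> UNIV" by (simp add: mem_Times_iff)
    qed
    \<comment> \<open>A separating set inside one vertical line must be all of that line; its image
      is a full open vertical segment, and the closure adds the end points.\<close>
    have "\<not> connected (- C)"
      using sep pq' unfolding connected_component_def by blast
    with sub have "C = {fst z} \<times> UNIV"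
      using connected_Compl_subset_vertical_line by blast
    then have "\<psi> (fst z, t) \<in> \<psi> ` C" for t
      by simp
    then have "{\<alpha> (fst z)} \<times> range \<beta> \<subseteq> \<psi> ` C"
      by (auto simp: \<psi>_def)
    then have "{\<alpha> (fst z)} \<times> {c<..<d} \<subseteq> - (U \<union> V)"
      using CF unfolding \<beta>(3) by (rule order_trans)
    then have "closure ({\<alpha> (fst z)} \<times> {c<..<d}) \<subseteq> - (U \<union> V)"
      using UV(1,2) by (intro closure_minimal) auto
    moreover have "\<alpha> (fst z) \<in> {a..b}"
      using rangeI[of \<alpha> "fst z"] unfolding \<alpha>(3) by simp
    ultimately show ?thesis
      using cd by (auto simp: closure_Times)
  qed
qed

text \<open>By \<open>meets\<close>, only the vertical alternative of the rectangle lemma can occur.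
  The horizontal range \<open>{a..b}\<close> is fixed before the vertical one, so that compactness
  of \<open>{a..b}\<close> yields one abscissa for all heights.\<close>

lemma connected_graph_if_meets_continua:
  fixes g :: "real \<Rightarrow> real" and I S :: "real set"
  assumes I: "open I" "convex I"
    and S: "closed S" "convex S" "interior S \<noteq> {}"
    and gS: "g ` I \<subseteq> S"
    and dense: "I \<times> S \<subseteq> closure ((\<lambda>x. (x, g x)) ` I)"
    and meets: "\<And>K. compact K \<Longrightarrow> connected K \<Longrightarrow> touches_two_vertical_lines K \<Longrightarrow> K \<subseteq> I \<times> interior S
        \<Longrightarrow> (\<lambda>x. (x, g x)) ` I \<inter> K \<noteq> {}"
  shows "connected ((\<lambda>x. (x, g x)) ` I)"
proof (rule connectedI)
  let ?G = "(\<lambda>x. (x, g x)) ` I"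
  fix U0 V0
  assume UV0: "open U0" "open V0" "U0 \<inter> ?G \<noteq> {}" "V0 \<inter> ?G \<noteq> {}" "U0 \<inter> V0 \<inter> ?G = {}" "?G \<subseteq> U0 \<union> V0"
  have GIS: "?G \<subseteq> I \<times> S" using gS by auto
  have opJ: "open (interior S)" "convex (interior S)"
    using S by auto
  have clJ: "closure (interior S) = S"
    using S convex_closure_interior[of S] by simp
  have opIJ: "open (I \<times> interior S)"
    using I by (simp add: open_Times)
  have hit: "\<exists>z. z \<in> O' \<inter> I \<times> interior S \<inter> ?G" if "open O'" "O' \<inter> I \<times> interior S \<noteq> {}" for O'
  proof -
    have "O' \<inter> I \<times> interior S \<inter> closure ?G \<noteq> {}"
      using that dense interior_subset by blast
    then show ?thesis
      using open_Int_closure_eq_empty[of "O' \<inter> I \<times> interior S" ?G] that(1) opIJ by auto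
  qed
  \<comment> \<open>Graph points may lie on the boundary of \<open>I \<times> S\<close>, but
    \<open>S\<close> is the closure of its interior, so neighbourhoods of them reach the open
    part.\<close>
  have approach: "O' \<inter> I \<times> interior S \<noteq> {}" if "open O'" "O' \<inter> ?G \<noteq> {}" for O'
  proof -
    have "I \<times> S \<subseteq> closure (I \<times> interior S)"
      using clJ closure_subset by (auto simp: closure_Times)
    then have "O' \<inter> closure (I \<times> interior S) \<noteq> {}"
      using that GIS by blast
    then show ?thesis
      using that(1) open_Int_closure_eq_empty[of O' "I \<times> interior S"] by auto
  qed
  define U where "U = U0 \<inter> I \<times> interior S"
  define V where "V = V0 \<inter> I \<times> interior S"
  have op: "open U" "open V"
    using UV0 opIJ by (auto simp: U_def V_def)
  \<comment> \<open>\<open>U0\<close> and \<open>V0\<close> are disjoint only on the graph; an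
    overlap inside the open part would contain a graph point by density.\<close>
  have "U \<inter> V = {}"
  proof (rule ccontr)
    assume "U \<inter> V \<noteq> {}"
    then have "U0 \<inter> V0 \<inter> I \<times> interior S \<noteq> {}"
      by (auto simp: U_def V_def)
    then show False
      using hit[of "U0 \<inter> V0"] UV0 by blast
  qed
  have "U \<noteq> {}" "V \<noteq> {}"
    unfolding U_def V_def by (intro approach UV0)+
  then obtain p q where p: "p \<in> U" and q: "q \<in> V"
    by blast
  then have pq: "fst p \<in> I" "fst q \<in> I" "snd p \<in> interior S" "snd q \<in> interior S"
    by (auto simp: U_def V_def mem_Times_iff)
  obtain a b where ab: "a < fst p" "a < fst q" "fst p < b" "fst q < b" "{a..b} \<subseteq> I"
    using open_convex_real_enlarge[OF I pq(1,2)] .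
  \<comment> \<open>This is the finite intersection property: finitely many heights, together with
    those of \<open>p\<close> and \<open>q\<close>, fit into one compact interval
    \<open>{c..d}\<close> inside \<open>interior S\<close>.\<close>
  have vertical: "\<exists>x\<in>{a..b}. {x} \<times> Y \<subseteq> - (U0 \<union> V0)" if Y: "finite Y" "Y \<subseteq> interior S" for Y
  proof -
    let ?Y = "Y \<union> {snd p, snd q}"
    have "Min ?Y \<in> ?Y"
      by (rule Min_in) (use Y in simp_all)
    moreover have "Max ?Y \<in> ?Y"
      by (rule Max_in) (use Y in simp_all)
    moreover have "?Y \<subseteq> interior S"
      using Y(2) pq by simp
    ultimately have "Min ?Y \<in> interior S" "Max ?Y \<in> interior S"
      by (simp_all only: subset_iff)
    then obtain c d where cd: "c < Min ?Y" "Max ?Y < d" "{c..d} \<subseteq> interior S"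
      by (rule open_convex_real_enlarge[OF opJ])
    have Ycd: "y \<in> {c<..<d}" if "y \<in> ?Y" for y
      using cd Min_le[of ?Y y] Max_ge[of ?Y y] Y that by auto
    have pin: "p \<in> U \<inter> {a<..<b} \<times> {c<..<d}" and qin: "q \<in> V \<inter> {a<..<b} \<times> {c<..<d}"
      using p q ab Ycd by (auto simp: mem_Times_iff)
    have less: "a < b" "c < d" using ab Ycd[of "snd p"] by auto
    have sub: "{a..b} \<times> {c..d} \<subseteq> I \<times> interior S"
      by (intro Sigma_mono ab cd)
    have compl: "X \<inter> (U0 \<union> V0) = {}" if "X \<subseteq> {a..b} \<times> {c..d}" "X \<inter> (U \<union> V) = {}" for X
      using that sub unfolding U_def V_def by blast
    show ?thesis
      using continuum_separating_in_rectangle[OF op \<open>U \<inter> V = {}\<close> less pin qin]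
    proof (elim disjE exE bexE conjE)
      fix K
      assume K: "compact K" "connected K" "K \<subseteq> {a..b} \<times> {c..d} - (U \<union> V)" "touches_two_vertical_lines K"
      then have "K \<subseteq> {a..b} \<times> {c..d}" by blast
      with sub have KIS: "K \<subseteq> I \<times> interior S" by (rule order_trans[rotated])
      have "K \<inter> (U0 \<union> V0) = {}"
        using K(3) by (intro compl) blast+
      then have "?G \<inter> K = {}" using UV0(6) by blast
      then show ?thesis using meets[OF K(1,2,4) KIS] by simp
    next
      fix x
      assume x: "x \<in> {a..b}" "{x} \<times> {c..d} \<subseteq> - (U \<union> V)"
      have "{x} \<times> {c..d} \<inter> (U0 \<union> V0) = {}"
        by (rule compl) (use x in auto)
      moreover have "Y \<subseteq> {c..d}" using Ycd by fastforce
      ultimately have "{x} \<times> Y \<subseteq> - (U0 \<union> V0)" by blast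
      with x(1) show ?thesis by blast
    qed
  qed
  have "{a..b} \<inter> (\<Inter>y\<in>interior S. (\<lambda>x. (x, y)) -` (- (U0 \<union> V0))) \<noteq> {}"
  proof (rule compact_imp_fip_image)
    show "closed ((\<lambda>x. (x, y)) -` (- (U0 \<union> V0)))" for y
      using UV0 by (intro closed_vimage) (auto intro!: continuous_intros)
    show "{a..b} \<inter> (\<Inter>y\<in>Y. (\<lambda>x. (x, y)) -` (- (U0 \<union> V0))) \<noteq> {}" if Y: "finite Y" "Y \<subseteq> interior S" for Y
    proof -
      obtain x where "x \<in> {a..b}" "{x} \<times> Y \<subseteq> - (U0 \<union> V0)"
        using vertical[OF Y] by blast
      then have "x \<in> {a..b} \<inter> (\<Inter>y\<in>Y. (\<lambda>x. (x, y)) -` (- (U0 \<union> V0)))"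
        by auto
      then show ?thesis by blast
    qed
  qed simp
  then obtain x where "x \<in> {a..b} \<inter> (\<Inter>y\<in>interior S. (\<lambda>x. (x, y)) -` (- (U0 \<union> V0)))"
    by blast
  then have x: "x \<in> {a..b}" and "{x} \<times> interior S \<subseteq> - (U0 \<union> V0)"
    by auto
  then have "closure ({x} \<times> interior S) \<subseteq> - (U0 \<union> V0)"
    using UV0(1,2) by (intro closure_minimal) auto
  moreover have "x \<in> I" using x ab by auto
  then have "(x, g x) \<in> closure ({x} \<times> interior S)"
    \<comment> \<open>The value \<open>g x\<close> itself may be an end point of \<open>S\<close>,
      which is why the line over \<open>interior S\<close> was closed up.\<close>
    using clJ gS by (auto simp: closure_Times)
  ultimately have "(x, g x) \<notin> U0 \<union> V0"
    by blast
  moreover have "(x, g x) \<in> U0 \<union> V0"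
    using UV0(6) \<open>x \<in> I\<close> by blast
  ultimately show False by simp
qed

section \<open>Continua separating a vertical strip\<close>

text \<open>A separation of \<open>S \<inter> C\<close> extends to one of \<open>S\<close> by adding
  \<open>D\<close> to the side that contains \<open>z\<close>, since \<open>D\<close> meets
  \<open>S \<inter> C\<close> only in \<open>z\<close>.\<close>

lemma connected_Int_closed_cut:
  fixes S :: "'a::topological_space set"
  assumes S: "connected S" and CD: "closed C" "closed D" "S \<subseteq> C \<union> D" and z: "S \<inter> C \<inter> D = {z}"
  shows "connected (S \<inter> C)"
proof -
  have no: False if "closed A" "closed B" "S \<inter> C \<subseteq> A \<union> B" "A \<inter> B \<inter> (S \<inter> C) = {}"
    "B \<inter> (S \<inter> C) \<noteq> {}" "z \<in> A" for A B
  proof -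
    have "closed (A \<inter> C \<union> D)" "closed (B \<inter> C)"
      by (intro closed_Un closed_Int that CD)+
    moreover have "S \<subseteq> (A \<inter> C \<union> D) \<union> (B \<inter> C)" using that CD by blast
    moreover have "z \<in> S \<inter> C \<inter> D" using z by simp
    then have "(A \<inter> C \<union> D) \<inter> S \<noteq> {}" by blast
    moreover have "B \<inter> C \<inter> S \<noteq> {}" using that by blast
    moreover have "(A \<inter> C \<union> D) \<inter> (B \<inter> C) \<inter> S = {}"
    proof (rule equals0I)
      fix w assume w: "w \<in> (A \<inter> C \<union> D) \<inter> (B \<inter> C) \<inter> S"
      then have "w \<notin> A" using that by blast
      with w have "w \<in> S \<inter> C \<inter> D" by blast
      with z have "w = z" by simp
      with \<open>w \<notin> A\<close> that show False by simp
    qed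
    ultimately show False
      using S unfolding connected_closed by metis
  qed
  show ?thesis
    unfolding connected_closed
  proof clarify
    fix A B
    assume AB: "closed A" "closed B" "S \<inter> C \<subseteq> A \<union> B" "A \<inter> B \<inter> (S \<inter> C) = {}"
      "A \<inter> (S \<inter> C) \<noteq> {}" "B \<inter> (S \<inter> C) \<noteq> {}"
    have "z \<in> S \<inter> C" using z by blast
    then have "z \<in> A \<or> z \<in> B" using AB by blast
    moreover have "S \<inter> C \<subseteq> B \<union> A" "B \<inter> A \<inter> (S \<inter> C) = {}" using AB by blast+
    ultimately show False
      using no[of A B] no[of B A] AB by metis
  qed
qed

text \<open>Each vertical line meets the graph in a single point, so the graph can be cut first at
  \<open>b\<close> and then at \<open>a\<close>.\<close>

lemma connected_graph_restrict:
  assumes "connected (graph_of f)"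
  shows "connected ((\<lambda>x. (x, f x)) ` {a..b})"
proof (cases "a \<le> b")
  case True
  let ?L = "{..b} \<times> UNIV" and ?R = "{a..} \<times> (UNIV :: real set)"
  have "connected (graph_of f \<inter> ?L)"
  proof (rule connected_Int_closed_cut)
    show "graph_of f \<inter> ?L \<inter> {b..} \<times> UNIV = {(b, f b)}"
      by (auto simp: graph_of_def)
    show "connected (graph_of f)" by (fact assms)
    show "graph_of f \<subseteq> ?L \<union> {b..} \<times> UNIV" by auto
  qed (intro closed_Times closed_atMost closed_atLeast closed_UNIV)+
  then have "connected (graph_of f \<inter> ?L \<inter> ?R)"
  proof (rule connected_Int_closed_cut)
    show "graph_of f \<inter> ?L \<inter> ?R \<inter> {..a} \<times> UNIV = {(a, f a)}"
      using True by (auto simp: graph_of_def)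
    show "graph_of f \<inter> ?L \<subseteq> ?R \<union> {..a} \<times> UNIV" by auto
  qed (intro closed_Times closed_atMost closed_atLeast closed_UNIV)+
  moreover have "graph_of f \<inter> ?L \<inter> ?R = (\<lambda>x. (x, f x)) ` {a..b}"
    by (auto simp: graph_of_def)
  ultimately show ?thesis by simp
qed simp

text \<open>The Fashoda meet theorem on crossing paths in a box, transported from
  \<open>real ^ 2\<close> along the coordinate bijection \<open>T\<close>.\<close>

lemma fashoda_prod:
  fixes f g :: "real \<Rightarrow> real \<times> real"
  assumes "path f" "path g" "path_image f \<subseteq> {a..b} \<times> {c..d}" "path_image g \<subseteq> {a..b} \<times> {c..d}"
    and "fst (pathstart f) = a" "fst (pathfinish f) = b" "snd (pathstart g) = c" "snd (pathfinish g) = d"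
  obtains z where "z \<in> path_image f" "z \<in> path_image g"
proof -
  define T :: "real \<times> real \<Rightarrow> real ^ 2" where "T z = (\<chi> i. if i = 1 then fst z else snd z)" for z
  have T1: "T z $ 1 = fst z" and T2: "T z $ 2 = snd z" for z
    by (auto simp: T_def)
  have "inj T"
  proof (rule injI)
    fix z w assume "T z = T w"
    then have "T z $ 1 = T w $ 1" "T z $ 2 = T w $ 2" by simp_all
    then show "z = w" by (simp add: T1 T2 prod_eq_iff)
  qed
  have "continuous_on UNIV T"
    unfolding T_def
  proof (rule continuous_on_vec_lambda)
    fix i :: 2
    show "continuous_on UNIV (\<lambda>z. if i = 1 then fst z else snd z :: real)"
      by (cases "i = 1") (auto intro!: continuous_intros)
  qed
  then have cont: "continuous_on X T" for X
    using continuous_on_subset by blast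
  have box: "T ` ({a..b} \<times> {c..d}) \<subseteq> cbox (T (a, c)) (T (b, d))"
    by (auto simp: mem_box_cart forall_2 T1 T2)
  obtain z where "z \<in> path_image (T \<circ> f)" "z \<in> path_image (T \<circ> g)"
  proof (rule fashoda[of "T \<circ> f" "T \<circ> g" "T (a, c)" "T (b, d)"])
    show "path (T \<circ> f)" "path (T \<circ> g)"
      using assms cont by (auto intro: path_continuous_image)
    show "path_image (T \<circ> f) \<subseteq> cbox (T (a, c)) (T (b, d))" "path_image (T \<circ> g) \<subseteq> cbox (T (a, c)) (T (b, d))"
      unfolding path_image_compose using assms(3,4) box by (meson image_mono subset_trans)+
  qed (use assms in \<open>auto simp: pathstart_compose pathfinish_compose T1 T2\<close>)
  then obtain u v where "u \<in> path_image f" "v \<in> path_image g" "T u = T v"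
    by (auto simp: path_image_compose)
  with \<open>inj T\<close> show thesis
    by (auto dest: injD intro: that)
qed

text \<open>A connected set need not be path connected, but its open \<open>e\<close>-neighbourhood
  is. That neighbourhood is connected as the image of \<open>K \<times> ball 0 e\<close> under
  addition.\<close>

lemma connected_path_near:
  fixes K :: "'a::euclidean_space set"
  assumes "connected K" "p \<in> K" "q \<in> K" "e > 0"
  obtains h where "path h" "pathstart h = p" "pathfinish h = q" "\<And>z. z \<in> path_image h \<Longrightarrow> \<exists>k\<in>K. dist k z < e"
proof -
  define N where "N = (\<Union>k\<in>K. ball k e)"
  have "connected ((\<lambda>z. fst z + snd z) ` (K \<times> ball 0 e))"
    using assms by (intro connected_continuous_image connected_Times continuous_intros) auto
  also have "(\<lambda>z. fst z + snd z) ` (K \<times> ball 0 e) = N"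
  proof
    show "(\<lambda>z. fst z + snd z) ` (K \<times> ball 0 e) \<subseteq> N"
      by (auto simp: N_def dist_norm)
    have "w \<in> (\<lambda>z. fst z + snd z) ` (K \<times> ball 0 e)" if "k \<in> K" "w \<in> ball k e" for k w
      using that by (intro image_eqI[of _ _ "(k, w - k)"]) (auto simp: dist_norm norm_minus_commute)
    then show "N \<subseteq> (\<lambda>z. fst z + snd z) ` (K \<times> ball 0 e)"
      by (auto simp only: N_def)
  qed
  finally have "connected N" .
  moreover have "open N"
    unfolding N_def by blast
  ultimately have "path_connected N"
    by (simp add: connected_open_path_connected)
  moreover have "K \<subseteq> N"
    unfolding N_def using assms(4) by auto
  ultimately obtain h where h: "path h" "path_image h \<subseteq> N" "pathstart h = p" "pathfinish h = q"
    using assms(2,3) unfolding path_connected_def by (meson subsetD)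
  show thesis
  proof (rule that[OF h(1,3,4)])
    fix z assume "z \<in> path_image h"
    then have "z \<in> N" using h(2) by blast
    then show "\<exists>k\<in>K. dist k z < e" by (simp add: N_def)
  qed
qed

text \<open>A path joining the two points off \<open>K\<close> extends by vertical segments to a
  bottom-to-top crossing of a large square. A path close to \<open>K\<close>, extended horizontally,
  crosses from left to right, so the crossings meet, though the first keeps a positive distance from
  \<open>K\<close>.\<close>

lemma continuum_separates_strip:
  fixes K :: "(real \<times> real) set"
  assumes K: "compact K" "connected K" and p0: "(x0, y0) \<in> K" and p1: "(x1, y1) \<in> K"
    and x: "x0 < x" "x < x1"
    and up: "\<And>y. y \<ge> yp \<Longrightarrow> (x, y) \<notin> K" and down: "\<And>y. y \<le> yq \<Longrightarrow> (x, y) \<notin> K"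
  shows "\<not> connected_component ({x0<..<x1} \<times> UNIV - K) (x, yp) (x, yq)"
proof
  let ?W = "{x0<..<x1} \<times> UNIV - K"
  assume "connected_component ?W (x, yp) (x, yq)"
  moreover have "open ?W"
    using K by (intro open_Diff open_Times compact_imp_closed) auto
  ultimately have "path_component ?W (x, yp) (x, yq)"
    by (simp add: open_path_connected_component)
  then obtain \<gamma> where \<gamma>: "path \<gamma>" "path_image \<gamma> \<subseteq> ?W" "pathstart \<gamma> = (x, yp)" "pathfinish \<gamma> = (x, yq)"
    unfolding path_component_def by blast
  have "bounded (K \<union> path_image \<gamma>)"
    using K \<gamma> by (simp add: compact_imp_bounded bounded_path_image)
  then obtain B where B: "\<And>z. z \<in> K \<union> path_image \<gamma> \<Longrightarrow> norm z \<le> B"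
    unfolding bounded_iff by blast
  \<comment> \<open>The extra 1 leaves room for the path \<open>h\<close>, which stays within
    distance 1 of \<open>K\<close>.\<close>
  define M where "M = B + 1"
  have inB: "\<bar>fst z\<bar> \<le> B \<and> \<bar>snd z\<bar> \<le> B" if "z \<in> K \<union> path_image \<gamma>" for z
    using B[OF that] norm_fst_le[of "fst z" "snd z"] norm_snd_le[of "snd z" "fst z"] by auto
  have ends: "(x, yp) \<in> path_image \<gamma>" "(x, yq) \<in> path_image \<gamma>"
    using \<gamma>(3,4) pathstart_in_path_image[of \<gamma>] pathfinish_in_path_image[of \<gamma>] by auto
  define v where "v = linepath (x, - M) (x, yq) +++ (reversepath \<gamma> +++ linepath (x, yp) (x, M))"
  have v: "path v" "snd (pathstart v) = - M" "snd (pathfinish v) = M"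
    unfolding v_def using \<gamma> by auto
  have v_image: "path_image v = closed_segment (x, - M) (x, yq) \<union> (path_image \<gamma> \<union> closed_segment (x, yp) (x, M))"
    unfolding v_def using \<gamma> by (simp add: path_image_join)
  have seg1: "fst z = x \<and> - M \<le> snd z \<and> snd z \<le> yq" if "z \<in> closed_segment (x, - M) (x, yq)" for z
    using closed_segment_PairD[of "fst z" "snd z" x "- M" x yq] that inB[of "(x, yq)"] ends
    by (auto simp: closed_segment_eq_real_ivl M_def split: if_splits)
  have seg2: "fst z = x \<and> yp \<le> snd z \<and> snd z \<le> M" if "z \<in> closed_segment (x, yp) (x, M)" for z
    using closed_segment_PairD[of "fst z" "snd z" x yp x M] that inB[of "(x, yp)"] ends
    by (auto simp: closed_segment_eq_real_ivl M_def split: if_splits)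
  have "z \<in> ?W \<and> z \<in> {-M..M} \<times> {-M..M}" if z: "z \<in> path_image v" for z
  proof -
    have xM: "- M \<le> x" "x \<le> M" "- M \<le> yp" "yq \<le> M"
      using inB[of "(x, yp)"] inB[of "(x, yq)"] ends by (auto simp: M_def)
    consider "z \<in> closed_segment (x, - M) (x, yq)" | "z \<in> path_image \<gamma>" | "z \<in> closed_segment (x, yp) (x, M)"
      using z unfolding v_image by blast
    then show ?thesis
    proof cases
      case 1
      then show ?thesis
        using seg1[OF 1] down[of "snd z"] x xM by (cases z) auto
    next
      case 2
      then show ?thesis
        using inB[of z] \<gamma>(2) by (cases z) (auto simp: M_def)
    next
      case 3
      then show ?thesis
        using seg2[OF 3] up[of "snd z"] x xM by (cases z) auto
    qed
  qed
  then have vW: "path_image v \<subseteq> ?W" and vM: "path_image v \<subseteq> {-M..M} \<times> {-M..M}"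
    by blast+
  have disj: "K \<inter> path_image v = {}"
    using Int_mono[OF order_refl vW, of K] by simp
  obtain \<delta> where \<delta>: "\<delta> > 0" "\<forall>k\<in>K. \<forall>z\<in>path_image v. \<delta> \<le> dist k z"
    using separate_compact_closed[OF K(1) closed_path_image[OF v(1)] disj] by auto
  obtain h where h: "path h" "pathstart h = (x0, y0)" "pathfinish h = (x1, y1)"
    and near: "\<And>z. z \<in> path_image h \<Longrightarrow> \<exists>k\<in>K. dist k z < min \<delta> 1"
    using connected_path_near[OF K(2) p0 p1, of "min \<delta> 1"] \<delta>(1) by auto
  define w where "w = linepath (- M, y0) (x0, y0) +++ (h +++ linepath (x1, y1) (M, y1))"
  have w: "path w" "fst (pathstart w) = - M" "fst (pathfinish w) = M"
    unfolding w_def using h by auto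
  have w_image: "path_image w = closed_segment (- M, y0) (x0, y0) \<union> (path_image h \<union> closed_segment (x1, y1) (M, y1))"
    unfolding w_def using h by (simp add: path_image_join)
  have y01: "\<bar>x0\<bar> \<le> M" "\<bar>y0\<bar> \<le> M" "\<bar>x1\<bar> \<le> M" "\<bar>y1\<bar> \<le> M"
    using inB[OF UnI1, OF p0] inB[OF UnI1, OF p1] by (simp_all add: M_def)
  have seg3: "snd z = y0 \<and> - M \<le> fst z \<and> fst z \<le> x0" if "z \<in> closed_segment (- M, y0) (x0, y0)" for z
    using closed_segment_PairD[of "fst z" "snd z" "- M" y0 x0 y0] that y01
    by (auto simp: closed_segment_eq_real_ivl split: if_splits)
  have seg4: "snd z = y1 \<and> x1 \<le> fst z \<and> fst z \<le> M" if "z \<in> closed_segment (x1, y1) (M, y1)" for z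
    using closed_segment_PairD[of "fst z" "snd z" x1 y1 M y1] that y01
    by (auto simp: closed_segment_eq_real_ivl split: if_splits)
  have hM: "\<bar>fst z\<bar> \<le> M \<and> \<bar>snd z\<bar> \<le> M" if z: "z \<in> path_image h" for z
  proof -
    obtain k where k: "k \<in> K" "dist k z < min \<delta> 1"
      using near[OF z] by blast
    then have "dist k z < 1" by simp
    have "\<bar>fst k - fst z\<bar> \<le> dist k z" "\<bar>snd k - snd z\<bar> \<le> dist k z"
      using dist_fst_le[of k z] dist_snd_le[of k z] by (auto simp: dist_real_def)
    with \<open>dist k z < 1\<close> show ?thesis
      using inB[OF UnI1, OF k(1)] unfolding M_def by linarith
  qed
  have wM: "path_image w \<subseteq> {-M..M} \<times> {-M..M}"
  proof
    fix z assume "z \<in> path_image w"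
    then consider "z \<in> closed_segment (- M, y0) (x0, y0)" | "z \<in> path_image h" | "z \<in> closed_segment (x1, y1) (M, y1)"
      unfolding w_image by blast
    then show "z \<in> {-M..M} \<times> {-M..M}"
      using seg3[of z] seg4[of z] hM[of z] y01 by cases (auto simp: mem_Times_iff)
  qed
  obtain z where zw: "z \<in> path_image w" and zv: "z \<in> path_image v"
    using fashoda_prod[OF w(1) v(1) wM vM w(2,3) v(2,3)] .
  \<comment> \<open>The crossing \<open>v\<close> stays strictly inside the strip and the horizontal
    extensions of \<open>h\<close> outside it, so the meeting point lies on \<open>h\<close>, closer
    to \<open>K\<close> than \<open>\<delta>\<close> allows.\<close>
  have "x0 < fst z" "fst z < x1"
    using zv vW by (auto simp: mem_Times_iff)
  then have "z \<notin> closed_segment (- M, y0) (x0, y0)" "z \<notin> closed_segment (x1, y1) (M, y1)"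
    using seg3[of z] seg4[of z] by linarith+
  then have "z \<in> path_image h"
    using zw unfolding w_image by blast
  then obtain k where k: "k \<in> K" "dist k z < min \<delta> 1"
    using near by blast
  with \<delta>(2)[rule_format, OF k(1) zv] show False
    by simp
qed

text \<open>If \<open>S\<close> is bounded above, its supremum works because interior points lie
  strictly below it; otherwise \<open>S\<close> contains points above the bounded set
  \<open>T\<close>.\<close>

lemma closed_real_point_above:
  fixes S T :: "real set"
  assumes "closed S" "S \<noteq> {}" "bounded T" "T \<subseteq> interior S"
  shows "\<exists>y\<in>S. \<forall>z\<ge>y. z \<notin> T"
proof (cases "bdd_above S")
  case True
  have "z \<notin> T" if "z \<ge> Sup S" for z
  proof
    assume "z \<in> T"
    then obtain e where e: "e > 0" "ball z e \<subseteq> S"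
      using assms(4) mem_interior by blast
    then have "z + e / 2 \<in> S" by (auto simp: subset_iff dist_real_def)
    then have "z + e / 2 \<le> Sup S" using True by (rule cSup_upper)
    with that e show False by simp
  qed
  then show ?thesis
    using closed_contains_Sup[OF assms(2) True assms(1)] by blast
next
  case False
  obtain B where B: "\<And>t. t \<in> T \<Longrightarrow> \<bar>t\<bar> \<le> B"
    using assms(3) unfolding bounded_iff by auto
  obtain y where "y \<in> S" "y > B"
    using False unfolding bdd_above_def by (meson not_le)
  moreover have "z \<notin> T" if "z \<ge> y" for z
    using B[of z] that \<open>y > B\<close> by auto
  ultimately show ?thesis by blast
qed

lemma closed_real_point_below:
  fixes S T :: "real set"
  assumes "closed S" "S \<noteq> {}" "bounded T" "T \<subseteq> interior S"
  shows "\<exists>y\<in>S. \<forall>z\<le>y. z \<notin> T"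
proof -
  have "\<exists>y\<in>uminus ` S. \<forall>z\<ge>y. z \<notin> uminus ` T"
    using assms
    by (intro closed_real_point_above) (auto simp: closed_negations interior_negations)
  then obtain y where y: "y \<in> S" "\<And>z. z \<ge> - y \<Longrightarrow> z \<notin> uminus ` T"
    by blast
  have "z \<notin> T" if "z \<le> y" for z
    using y(2)[of "- z"] that by auto
  with y(1) show ?thesis by blast
qed

lemma connected_graph_meets_continuum:
  assumes conn: "connected (graph_of f)"
    and K: "continuum K" "K \<subseteq> interior (closure (graph_of f))" "touches_two_vertical_lines K"
  shows "graph_of f \<inter> K \<noteq> {}"
proof
  assume disj: "graph_of f \<inter> K = {}"
  have cK: "compact K" "connected K"
    using K by (auto simp: continuum_def)
  obtain p0 p1 where "p0 \<in> K" "p1 \<in> K" "fst p0 < fst p1"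
    using K(3) unfolding touches_two_vertical_lines_def by (metis linorder_neq_iff)
  then obtain x0 y0 x1 y1 where p01: "(x0, y0) \<in> K" "(x1, y1) \<in> K" "x0 < x1"
    by (metis prod.collapse)
  define x where "x = (x0 + x1) / 2"
  have x: "x0 < x" "x < x1" using p01 by (auto simp: x_def)
  let ?\<Gamma> = "closure (graph_of f)"
  \<comment> \<open>On the vertical line through the middle, the slice of \<open>K\<close> lies in
    the interior of the slice of the closed graph; this gives closure points above and below
    \<open>K\<close>.\<close>
  let ?S = "(\<lambda>y. (x, y)) -` ?\<Gamma>" and ?T = "(\<lambda>y. (x, y)) -` K"
  have "closed ?S"
    by (intro closed_vimage) (auto intro!: continuous_intros)
  moreover have "(x, f x) \<in> ?\<Gamma>"
    using closure_subset[of "graph_of f"] by (auto simp: graph_of_def)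
  then have "?S \<noteq> {}" by blast
  moreover have "bounded ?T"
  proof -
    have "?T \<subseteq> snd ` K" by force
    then show ?thesis
      using cK bounded_snd compact_imp_bounded bounded_subset by metis
  qed
  moreover have "?T \<subseteq> interior ?S"
  proof (rule interior_maximal[THEN order_trans[rotated]])
    show "(\<lambda>y. (x, y)) -` interior ?\<Gamma> \<subseteq> ?S"
      using interior_subset by blast
    show "open ((\<lambda>y. (x, y)) -` interior ?\<Gamma>)"
      by (intro open_vimage) (auto intro!: continuous_intros)
    show "?T \<subseteq> (\<lambda>y. (x, y)) -` interior ?\<Gamma>"
      using K(2) by blast
  qed
  ultimately obtain yp yq where
    yp: "(x, yp) \<in> ?\<Gamma>" "\<And>y. y \<ge> yp \<Longrightarrow> (x, y) \<notin> K" and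
    yq: "(x, yq) \<in> ?\<Gamma>" "\<And>y. y \<le> yq \<Longrightarrow> (x, y) \<notin> K"
    using closed_real_point_above[of ?S ?T] closed_real_point_below[of ?S ?T] by auto
  let ?W = "{x0<..<x1} \<times> UNIV - K"
  have sep: "\<not> connected_component ?W (x, yp) (x, yq)"
    by (rule continuum_separates_strip[OF cK p01(1,2) x yp(2) yq(2)])
  have "open ?W"
    using cK by (intro open_Diff open_Times compact_imp_closed) auto
  \<comment> \<open>Components of an open set are open, so the component of a point in the closure
    of the graph contains a graph point.\<close>
  have near: "\<exists>a. connected_component ?W z (a, f a)" if "z \<in> ?W" "z \<in> ?\<Gamma>" for z
  proof -
    have "open (connected_component_set ?W z)"
      using \<open>open ?W\<close> by (rule open_connected_component)
    moreover have "z \<in> connected_component_set ?W z"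
      using that(1) by (simp add: connected_component_refl)
    ultimately have "connected_component_set ?W z \<inter> graph_of f \<noteq> {}"
      using that(2) open_Int_closure_eq_empty by blast
    then show ?thesis by (auto simp: graph_of_def)
  qed
  have "(x, yp) \<in> ?W" "(x, yq) \<in> ?W"
    using x yp(2)[of yp] yq(2)[of yq] by auto
  then obtain a b where a: "connected_component ?W (x, yp) (a, f a)"
    and b: "connected_component ?W (x, yq) (b, f b)"
    using near yp(1) yq(1) by blast
  \<comment> \<open>Only the part of the graph between \<open>a\<close> and \<open>b\<close> is
    used, as it stays inside the strip.\<close>
  let ?A = "(\<lambda>t. (t, f t)) ` {min a b..max a b}"
  have "(a, f a) \<in> ?W" "(b, f b) \<in> ?W"
    using a b connected_component_in by blast+
  then have "?A \<subseteq> ?W"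
    using disj by (auto simp: graph_of_def min_def max_def split: if_splits)
  moreover have "connected ?A"
    using conn by (rule connected_graph_restrict)
  ultimately have "connected_component ?W (a, f a) (b, f b)"
    unfolding connected_component_def by (intro exI[of _ ?A]) auto
  then show False
    using sep a b by (meson connected_component_sym connected_component_trans)
qed

section \<open>Graphs of discontinuous monomial functions\<close>

text \<open>
  The map \<open>(x, y) \<mapsto> (x, y * x ^ n)\<close> carries \<open>{0<..} \<times> ratio_set n f\<close> onto the part of the closure
  of the graph of \<open>f\<close> over the positive half-line.
\<close>

lemma monomial_fun_connected_graph_pos:
  assumes n: "n \<ge> 1" and f: "monomial_fun n f" and disc: "\<not> continuous_on UNIV f"
    and meets: "\<And>K. continuum K \<Longrightarrow> K \<subseteq> interior (closure (graph_of f)) \<Longrightarrow> touches_two_vertical_lines K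
         \<Longrightarrow> graph_of f \<inter> K \<noteq> {}"
  shows "connected ((\<lambda>x. (x, f x)) ` {0<..})"
proof -
  let ?S = "ratio_set n f" and ?g = "\<lambda>x. f x / x ^ n"
  let ?G = "(\<lambda>x. (x, ?g x)) ` {0<..}"
  define \<phi> where "\<phi> = (\<lambda>z::real \<times> real. (fst z, snd z * fst z ^ n))"
  have cont: "continuous_on X \<phi>" for X
    unfolding \<phi>_def by (intro continuous_intros)
  have \<phi>_graph: "\<phi> ` ?G = (\<lambda>x. (x, f x)) ` {0<..}"
    unfolding image_image \<phi>_def by (rule image_cong) auto
  \<comment> \<open>This is the image of \<open>{0<..} \<times> interior ?S\<close> under
    \<open>\<phi>\<close>, written as a preimage so that it is visibly open.\<close>
  define W where "W = {0<..} \<times> UNIV \<inter> (\<lambda>z. snd z / fst z ^ n) -` interior ?S"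
  have "open W"
    unfolding W_def
    by (rule continuous_open_preimage) (auto intro!: continuous_intros open_Times)
  have "W \<subseteq> closure (graph_of f)"
  proof
    fix z assume z: "z \<in> W"
    then have "(fst z, snd z / fst z ^ n) \<in> {0<..} \<times> ?S"
      using interior_subset by (auto simp: W_def)
    then have "\<phi> (fst z, snd z / fst z ^ n) \<in> \<phi> ` closure ?G"
      using graph_ratio_dense[OF f] by blast
    also have "\<phi> ` closure ?G \<subseteq> closure (graph_of f)"
    proof (rule image_closure_subset[OF cont closed_closure])
      show "\<phi> ` ?G \<subseteq> closure (graph_of f)"
        unfolding \<phi>_graph using closure_subset[of "graph_of f"] by (auto simp: graph_of_def)
    qed
    finally show "z \<in> closure (graph_of f)"
      using z by (auto simp: \<phi>_def W_def)
  qed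
  then have W: "W \<subseteq> interior (closure (graph_of f))"
    using \<open>open W\<close> by (rule interior_maximal)
  have "connected ?G"
  proof (rule connected_graph_if_meets_continua)
    show "closed ?S" by (simp add: ratio_set_def)
    show "convex ?S" by (rule convex_ratio_set[OF f])
    show "interior ?S \<noteq> {}" by (rule interior_ratio_set_nonempty[OF n f disc])
    show "?g ` {0<..} \<subseteq> ?S" unfolding ratio_set_def by (rule closure_subset)
    show "{0<..} \<times> ?S \<subseteq> closure ?G" by (rule graph_ratio_dense[OF f])
    fix K :: "(real \<times> real) set"
    assume K: "compact K" "connected K" "touches_two_vertical_lines K" "K \<subseteq> {0<..} \<times> interior ?S"
    have cK: "compact (\<phi> ` K)" "connected (\<phi> ` K)"
      using K cont by (auto intro: compact_continuous_image connected_continuous_image)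
    have tK: "touches_two_vertical_lines (\<phi> ` K)"
      using K(3) by (auto simp: touches_two_vertical_lines_def \<phi>_def)
    have "\<phi> ` K \<subseteq> W"
      using K(4) by (auto simp: \<phi>_def W_def)
    then have "graph_of f \<inter> \<phi> ` K \<noteq> {}"
      using W tK by (intro meets touches_two_vertical_lines_imp_continuum cK) auto
    then obtain x y where "(x, y) \<in> K" "y * x ^ n = f x"
      by (auto simp: graph_of_def \<phi>_def)
    moreover from this have "x > 0"
      using K(4) by auto
    ultimately have "(x, y) = (x, ?g x)" "x > 0"
      by (auto simp: field_simps)
    then show "?G \<inter> K \<noteq> {}"
      using \<open>(x, y) \<in> K\<close> by auto
  qed auto
  then show ?thesis
    unfolding \<phi>_graph[symmetric] using cont by (rule connected_continuous_image[rotated])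
qed

text \<open>Along the points \<open>1 / (k + 1)\<close> rational homogeneity gives the values
  \<open>f 1 / (k + 1) ^ n\<close>, which tend to \<open>0 = f 0\<close> because
  \<open>n \<ge> 1\<close>.\<close>

lemma monomial_fun_zero_in_closure_graph_pos:
  assumes n: "n \<ge> 1" and f: "monomial_fun n f"
  shows "(0, f 0) \<in> closure ((\<lambda>x. (x, f x)) ` {0<..})"
proof -
  let ?q = "\<lambda>k. inverse (real (Suc k))"
  have f0: "f 0 = 0"
    using monomial_fun_of_nat_mult[OF f, of 0 1] n by simp
  have "?q \<longlonglongrightarrow> 0"
    by (rule LIMSEQ_inverse_real_of_nat)
  then have "(\<lambda>k. (?q k, ?q k ^ n * f 1)) \<longlonglongrightarrow> (0, 0 ^ n * f 1)"
    by (intro tendsto_intros)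
  moreover have "f (?q k) = ?q k ^ n * f 1" for k
    using monomial_fun_rat_mult[OF f, of "?q k" 1] by simp
  ultimately have "(\<lambda>k. (?q k, f (?q k))) \<longlonglongrightarrow> (0, f 0)"
    using n f0 by (simp add: zero_power)
  moreover have "(?q k, f (?q k)) \<in> (\<lambda>x. (x, f x)) ` {0<..}" for k
    by auto
  ultimately show ?thesis
    unfolding closure_sequential by (intro exI[of _ "\<lambda>k. (?q k, f (?q k))"]) blast
qed

lemma monomial_fun_connected_graph:
  assumes n: "n \<ge> 1" and f: "monomial_fun n f"
    and conn: "connected ((\<lambda>x. (x, f x)) ` {0<..})"
  shows "connected (graph_of f)"
proof -
  let ?P = "(\<lambda>x. (x, f x)) ` {0..}" and ?N = "(\<lambda>x. (x, f x)) ` {..0}"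
  \<comment> \<open>By parity this linear map carries the graph over the nonnegative half-line to
    the graph over the nonpositive one.\<close>
  let ?r = "\<lambda>z::real \<times> real. (- fst z, (- 1) ^ n * snd z)"
  have "connected ?P"
  proof (rule connected_intermediate_closure[OF conn])
    have "?P = insert (0, f 0) ((\<lambda>x. (x, f x)) ` {0<..})"
      by (force simp: image_iff)
    then show "?P \<subseteq> closure ((\<lambda>x. (x, f x)) ` {0<..})"
      using monomial_fun_zero_in_closure_graph_pos[OF n f] by (simp add: closure_subset)
  qed auto
  have "?r ` ?P = (\<lambda>x. (- x, f (- x))) ` {0..}"
    by (simp add: image_image monomial_fun_uminus[OF f])
  also have "\<dots> = (\<lambda>x. (x, f x)) ` uminus ` {0..}"
    by (simp only: image_image)
  also have "uminus ` {0..} = {..0::real}"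
    by simp
  finally have "?r ` ?P = ?N" .
  moreover have "connected (?r ` ?P)"
    by (rule connected_continuous_image[OF _ \<open>connected ?P\<close>]) (intro continuous_intros)
  ultimately have "connected ?N" by simp
  moreover have "(0, f 0) \<in> ?P \<inter> ?N" by auto
  ultimately have "connected (?P \<union> ?N)"
    using \<open>connected ?P\<close> by (intro connected_Un) auto
  also have "?P \<union> ?N = graph_of f"
    by (auto simp: graph_of_def image_iff)
  finally show ?thesis .
qed

theorem theorem5:
  fixes f :: "real \<Rightarrow> real" and n :: nat
  assumes "n \<ge> 1"
    and "monomial_fun n f"
    and "\<not> continuous_on UNIV f"
  shows "connected (graph_of f) \<longleftrightarrow>
    (\<forall>K. continuum K \<and> K \<subseteq> interior (closure (graph_of f)) \<and> touches_two_vertical_lines K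
         \<longrightarrow> graph_of f \<inter> K \<noteq> {})"
proof
  assume "connected (graph_of f)"
  then show "\<forall>K. continuum K \<and> K \<subseteq> interior (closure (graph_of f)) \<and> touches_two_vertical_lines K
         \<longrightarrow> graph_of f \<inter> K \<noteq> {}"
    using connected_graph_meets_continuum by blast
next
  assume "\<forall>K. continuum K \<and> K \<subseteq> interior (closure (graph_of f)) \<and> touches_two_vertical_lines K
         \<longrightarrow> graph_of f \<inter> K \<noteq> {}"
  then have "connected ((\<lambda>x. (x, f x)) ` {0<..})"
    by (intro monomial_fun_connected_graph_pos[OF assms]) blast
  then show "connected (graph_of f)"
    by (rule monomial_fun_connected_graph[OF assms(1,2)])
qed

end
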